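(* Let $\{S_i\}_{i\in\mathcal{I}}$ be an IFS satisfying the weak separation condition. Then its transition graph $\mathcal{G}$ has a unique essential class.
   Context: IFS. An iterated function system of similarities (IFS) is a finite set of maps $S_i(x)=r_ix+d_i$ on $\mathbb{R}$, $i\in\mathcal{I}$, with $0<|r_i|<1$ and $\#\mathcal{I}\ge 2$. Its attractor $K$ is the unique non-empty compact set with $K=\bigcup_{i}S_i(K)$. Standing assumptions: $K$ is not a singleton and (normalization) the convex hull of $K$ is $[0,1]$. $\mathcal{I}^*$ is the set of finite words; for $\sigma=(\sigma_1,\dots,\sigma_n)$, $S_\sigma=S_{\sigma_1}\circ\cdots\circ S_{\sigma_n}$, $r_\sigma=\prod r_{\sigma_k}$, and $\sigma^-$ is $\sigma$ with the last letter deleted; for the empty word $S_\emptyset=\mathrm{id}$, $r_\emptyset=1$. For $t>0$, $\Lambda_t=\{\sigma\in\mathcal I^*:|r_\sigma|<t\le|r_{\sigma^-}|\}$ (convention: $|r_{\emptyset^-}|=\infty$, so $\Lambda_t=\{\emptyset\}$ for $t>1$). Weak separation condition. $U(x,t)$ is the open ball of centre $x$ and radius $t$. For Borel $E$, $\mathcal{S}_t(E)=\{S_\sigma:\sigma\in\Lambda_t,\ S_\sigma(K)\cap E\ne\emptyset\}$ (a set of functions). The weak separation condition is $\sup_{x\in\mathbb{R},t>0}\#\mathcal{S}_t(U(x,t))<\infty$. Net intervals. For $t>0$ let $h_1<\dots<h_{s(t)}$ be the distinct elements of $\{S_\sigma(0),S_\sigma(1):\sigma\in\Lambda_t\}$.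 The net intervals of generation $t$ are the elements of $\mathcal{F}_t=\{[h_j,h_{j+1}]:1\le j<s(t),\ (h_j,h_{j+1})\cap K\ne\emptyset\}$. A net interval is always considered together with its generation. $T_\Delta(x)=rx+a$ is the map with $r>0$ and $T_\Delta([0,1])=\Delta$. The neighbour set of $\Delta\in\mathcal F_t$ is $\mathcal V(\Delta)=\mathcal{V}_t(\Delta)=\{T_\Delta^{-1}\circ S_\sigma:\sigma\in\Lambda_t,\ S_\sigma(K)\cap\Delta^\circ\neq\emptyset\}$ (a set of functions). The transition generation is $\operatorname{tg}(\Delta)=\operatorname{diam}(\Delta)\cdot\max\{|R|:(x\mapsto Rx+a)\in\mathcal V(\Delta)\}$; the children of $\Delta$ are the net intervals of generation $\operatorname{tg}(\Delta)$ contained in $\Delta$. The position index of a child $\Delta'=[a',b']$ of $\Delta=[a,b]$ is $q(\Delta,\Delta')=(a'-a)/\operatorname{diam}(\Delta)$. Transition graph. $\mathcal G$ is the directed graph (loops, multiple edges allowed) with vertices the distinct neighbour sets of net intervals, and with an edge $(\mathcal V(\Delta),\mathcal V(\Delta'),q(\Delta,\Delta'))$ from $\mathcal V(\Delta)$ to $\mathcal V(\Delta')$ for each net interval $\Delta$ and child $\Delta'$ of $\Delta$ (the outgoing edges depend only on $\mathcal V(\Delta)$). A path is a sequence of consecutive edges. An essential class is a (non-empty) induced subgraph $\mathcal G'$ of $\mathcal G$ such that (i) for any vertices $v,v'$ of $\mathcal G'$ there is a path from $v$ to $v'$, and (ii) if $v'\in\mathcal G'$, $v\in\mathcal G$ and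 there is a path from $v'$ to $v$, then $v\in\mathcal G'$. *)

theory Defs
  imports "HOL-Analysis.Analysis" "Graph_Theory.Digraph_Component" "Graph_Theory.Arc_Walk"
begin

section \<open>Iterated function systems of similarities\<close>

text \<open>The IFS is an indexed family of maps (so \<open>S i = S j\<close> with \<open>i \<noteq> j\<close> is allowed), given
  by the contraction ratios \<open>r\<close> and translations \<open>d\<close> on an index set \<open>I\<close>.\<close>

definition similarity_ifs :: "'i set \<Rightarrow> ('i \<Rightarrow> real) \<Rightarrow> bool" where
  "similarity_ifs I r \<longleftrightarrow> finite I \<and> card I \<ge> 2 \<and> (\<forall>i\<in>I. 0 < \<bar>r i\<bar> \<and> \<bar>r i\<bar> < 1)"

definition sim_map :: "('i \<Rightarrow> real) \<Rightarrow> ('i \<Rightarrow> real) \<Rightarrow> 'i \<Rightarrow> real \<Rightarrow> real" where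
  "sim_map r d i = (\<lambda>x. r i * x + d i)"

definition is_attractor ::
    "'i set \<Rightarrow> ('i \<Rightarrow> real) \<Rightarrow> ('i \<Rightarrow> real) \<Rightarrow> real set \<Rightarrow> bool" where
  "is_attractor I r d K \<longleftrightarrow> compact K \<and> K \<noteq> {} \<and> K = (\<Union>i\<in>I. sim_map r d i ` K)"

definition word_map :: "('i \<Rightarrow> real) \<Rightarrow> ('i \<Rightarrow> real) \<Rightarrow> 'i list \<Rightarrow> real \<Rightarrow> real" where
  "word_map r d \<sigma> = foldr (\<lambda>i f. sim_map r d i \<circ> f) \<sigma> id"

definition word_ratio :: "('i \<Rightarrow> real) \<Rightarrow> 'i list \<Rightarrow> real" where
  "word_ratio r \<sigma> = prod_list (map r \<sigma>)"

text \<open>The disjunct \<open>\<sigma> = []\<close> encodes the convention that the ratio of the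
  predecessor of the empty word is infinite.\<close>

definition words_gen :: "'i set \<Rightarrow> ('i \<Rightarrow> real) \<Rightarrow> real \<Rightarrow> 'i list set" where
  "words_gen I r t =
     {\<sigma> \<in> lists I. \<bar>word_ratio r \<sigma>\<bar> < t \<and> (\<sigma> = [] \<or> t \<le> \<bar>word_ratio r (butlast \<sigma>)\<bar>)}"


section \<open>The weak separation condition\<close>

definition maps_meeting ::
    "'i set \<Rightarrow> ('i \<Rightarrow> real) \<Rightarrow> ('i \<Rightarrow> real) \<Rightarrow> real set \<Rightarrow> real \<Rightarrow> real set \<Rightarrow> (real \<Rightarrow> real) set"
  where
  "maps_meeting I r d K t E =
     {word_map r d \<sigma> | \<sigma>. \<sigma> \<in> words_gen I r t \<and> word_map r d \<sigma> ` K \<inter> E \<noteq> {}}"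

text \<open>Finiteness is stated separately because \<open>card\<close> is \<open>0\<close> on infinite sets.\<close>

definition weak_separation ::
    "'i set \<Rightarrow> ('i \<Rightarrow> real) \<Rightarrow> ('i \<Rightarrow> real) \<Rightarrow> real set \<Rightarrow> bool" where
  "weak_separation I r d K \<longleftrightarrow>
     (\<exists>N. \<forall>x. \<forall>t>0. finite (maps_meeting I r d K t (ball x t)) \<and>
        card (maps_meeting I r d K t (ball x t)) \<le> N)"


section \<open>Net intervals and neighbour sets\<close>

definition endpoints_gen ::
    "'i set \<Rightarrow> ('i \<Rightarrow> real) \<Rightarrow> ('i \<Rightarrow> real) \<Rightarrow> real \<Rightarrow> real set" where
  "endpoints_gen I r d t = (\<Union>\<sigma>\<in>words_gen I r t. {word_map r d \<sigma> 0, word_map r d \<sigma> 1})"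

text \<open>The points \<open>a = h\<^sub>j\<close> and \<open>b = h\<^sub>j\<^sub>+\<^sub>1\<close> are consecutive elements of
  the set of endpoints.\<close>

definition net_intervals ::
    "'i set \<Rightarrow> ('i \<Rightarrow> real) \<Rightarrow> ('i \<Rightarrow> real) \<Rightarrow> real set \<Rightarrow> real \<Rightarrow> real set set" where
  "net_intervals I r d K t =
     {{a..b} | a b. a \<in> endpoints_gen I r d t \<and> b \<in> endpoints_gen I r d t \<and> a < b \<and>
        endpoints_gen I r d t \<inter> {a<..<b} = {} \<and> {a<..<b} \<inter> K \<noteq> {}}"

text \<open>For \<open>\<Delta> = {a..b}\<close> this is the increasing affine map \<open>x \<mapsto> (b - a) * x + a\<close>
  taking \<open>{0..1}\<close> onto \<open>\<Delta>\<close>.\<close>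

definition interval_map :: "real set \<Rightarrow> real \<Rightarrow> real" where
  "interval_map \<Delta> = (\<lambda>x. diameter \<Delta> * x + Inf \<Delta>)"

definition neighbour_set ::
    "'i set \<Rightarrow> ('i \<Rightarrow> real) \<Rightarrow> ('i \<Rightarrow> real) \<Rightarrow> real set \<Rightarrow> real \<Rightarrow> real set \<Rightarrow> (real \<Rightarrow> real) set"
  where
  "neighbour_set I r d K t \<Delta> =
     {inv (interval_map \<Delta>) \<circ> word_map r d \<sigma> | \<sigma>.
        \<sigma> \<in> words_gen I r t \<and> word_map r d \<sigma> ` K \<inter> interior \<Delta> \<noteq> {}}"

definition transition_gen ::
    "'i set \<Rightarrow> ('i \<Rightarrow> real) \<Rightarrow> ('i \<Rightarrow> real) \<Rightarrow> real set \<Rightarrow> real \<Rightarrow> real set \<Rightarrow> real" where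
  "transition_gen I r d K t \<Delta> =
     diameter \<Delta> * Max {\<bar>R\<bar> | R a. (\<lambda>x. R * x + a) \<in> neighbour_set I r d K t \<Delta>}"

definition children ::
    "'i set \<Rightarrow> ('i \<Rightarrow> real) \<Rightarrow> ('i \<Rightarrow> real) \<Rightarrow> real set \<Rightarrow> real \<Rightarrow> real set \<Rightarrow> real set set" where
  "children I r d K t \<Delta> =
     {\<Delta>' \<in> net_intervals I r d K (transition_gen I r d K t \<Delta>). \<Delta>' \<subseteq> \<Delta>}"

definition position_index :: "real set \<Rightarrow> real set \<Rightarrow> real" where
  "position_index \<Delta> \<Delta>' = (Inf \<Delta>' - Inf \<Delta>) / diameter \<Delta>"


section \<open>The transition graph\<close>

type_synonym vertex = "(real \<Rightarrow> real) set"
type_synonym edge = "vertex \<times> vertex \<times> real"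

definition transition_graph ::
    "'i set \<Rightarrow> ('i \<Rightarrow> real) \<Rightarrow> ('i \<Rightarrow> real) \<Rightarrow> real set \<Rightarrow> (vertex, edge) pre_digraph" where
  "transition_graph I r d K =
     \<lparr>verts = {neighbour_set I r d K t \<Delta> | t \<Delta>. 0 < t \<and> \<Delta> \<in> net_intervals I r d K t},
      arcs = {(neighbour_set I r d K t \<Delta>,
               neighbour_set I r d K (transition_gen I r d K t \<Delta>) \<Delta>',
               position_index \<Delta> \<Delta>')
              | t \<Delta> \<Delta>'. 0 < t \<and> \<Delta> \<in> net_intervals I r d K t \<and> \<Delta>' \<in> children I r d K t \<Delta>},
      tail = fst,
      head = (\<lambda>e. fst (snd e))\<rparr>"

text \<open>A path is a sequence of one or more consecutive edges.\<close>

definition path_from_to :: "('v, 'e) pre_digraph \<Rightarrow> 'v \<Rightarrow> 'v \<Rightarrow> bool" where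
  "path_from_to G v w \<longleftrightarrow> (\<exists>p. p \<noteq> [] \<and> pre_digraph.awalk G v p w)"

definition essential_class :: "('v, 'e) pre_digraph \<Rightarrow> ('v, 'e) pre_digraph \<Rightarrow> bool" where
  "essential_class H G \<longleftrightarrow>
     induced_subgraph H G \<and> verts H \<noteq> {} \<and>
     (\<forall>v\<in>verts H. \<forall>v'\<in>verts H. path_from_to G v v') \<and>
     (\<forall>v'\<in>verts H. \<forall>v\<in>verts G. path_from_to G v' v \<longrightarrow> v \<in> verts H)"

end

(*
  A vertex v0 reachable from every vertex yields exactly one essential class, the set of
  vertices reachable from v0. To find v0, take a ball U(x,t), t <= 1, meeting the maximal
  number of maps of its generation. For every word w, the images under S_w of these maps
  exhaust, by maximality, the maps of generation |r_w| t meeting S_w(U(x,t)). Hence if D is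
  a net interval of generation s <= t inside U(x,t) and r_w > 0, then S_w(D) is a net
  interval of generation r_w s with the same neighbour set v0 as D. Every net interval
  contains such a copy S_w(D), and a net interval contained in another one is reached from
  it through successive children, because the neighbour set of a net interval does not
  change between its generation and its transition generation.
*)

theory Submission
  imports Defs
begin

section \<open>Essential classes and globally reachable vertices\<close>

context wf_digraph
begin

lemma path_from_to_iff: "path_from_to G v w \<longleftrightarrow> v \<rightarrow>\<^sup>+\<^bsub>G\<^esub> w"
  unfolding path_from_to_def reachable1_awalk by blast

text \<open>Each vertex reachable from \<open>v0\<close> leads back to \<open>v0\<close>, hence to
  all the others, and transitivity closes the set. Conversely, an essential class is non-empty and
  closed, so it contains \<open>v0\<close>, and then connectivity and closedness force the same
  vertex set.\<close>

lemma ex1_essential_class: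
  assumes v0: "v0 \<in> verts G" and reach: "\<And>v. v \<in> verts G \<Longrightarrow> path_from_to G v v0"
  shows "\<exists>!H. essential_class H G"
proof -
  define P where "P = {v \<in> verts G. path_from_to G v0 v}"
  define H where "H = \<lparr>verts = P, arcs = {e \<in> arcs G. tail G e \<in> P \<and> head G e \<in> P},
    tail = tail G, head = head G\<rparr>"
  have trans: "path_from_to G u w" if "path_from_to G u v" "path_from_to G v w" for u v w
    using that unfolding path_from_to_iff by (rule trancl_trans)
  have "wf_digraph H"
    by unfold_locales (auto simp: H_def)
  then have "induced_subgraph H G"
    unfolding induced_subgraph_def subgraph_def compatible_def
    using wf_digraph_axioms by (auto simp: H_def P_def)
  \<comment> \<open>A path has at least one edge, so this is not reflexivity: it is
    \<open>reach\<close> at \<open>v0\<close> itself.\<close>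
  have "v0 \<in> P"
    using v0 reach by (auto simp: P_def)
  have "essential_class H G"
  proof -
    have "path_from_to G v v'" if "v \<in> P" "v' \<in> P" for v v'
      using that trans[OF reach, of v v'] by (simp add: P_def)
    moreover have "v \<in> P" if "v' \<in> P" "v \<in> verts G" "path_from_to G v' v" for v v'
      using that trans[of v0 v' v] by (simp add: P_def)
    moreover have "verts H = P" by (simp add: H_def)
    ultimately show ?thesis
      using \<open>induced_subgraph H G\<close> \<open>v0 \<in> P\<close> unfolding essential_class_def by blast
  qed
  moreover have "H' = H" if "essential_class H' G" for H' :: "('a, 'b) pre_digraph"
  proof -
    have ind: "induced_subgraph H' G" and ne: "verts H' \<noteq> {}"
      and conn: "\<And>v v'. v \<in> verts H' \<Longrightarrow> v' \<in> verts H' \<Longrightarrow> path_from_to G v v'"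
      and closed: "\<And>v v'. v' \<in> verts H' \<Longrightarrow> v \<in> verts G \<Longrightarrow> path_from_to G v' v \<Longrightarrow> v \<in> verts H'"
      using that unfolding essential_class_def by blast+
    \<comment> \<open>An induced subgraph is determined by its vertices, so only
      \<open>verts H' = P\<close> remains.\<close>
    have sub: "verts H' \<subseteq> verts G" and comp: "tail H' = tail G" "head H' = head G"
      and arcs: "arcs H' = {e \<in> arcs G. tail G e \<in> verts H' \<and> head G e \<in> verts H'}"
      using ind unfolding induced_subgraph_def subgraph_def compatible_def by auto
    have "v0 \<in> verts H'"
      using ne sub closed v0 reach by blast
    then have "verts H' \<subseteq> P" "P \<subseteq> verts H'"
      using sub conn closed unfolding P_def by blast+
    then have "verts H' = P" by simp
    then show ?thesis
      using comp arcs by (simp add: H_def)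
  qed
  ultimately show ?thesis by blast
qed

end

section \<open>Words and their maps\<close>

lemma word_map_Nil [simp]: "word_map r d [] = id"
  and word_map_Cons [simp]: "word_map r d (i # \<sigma>) = sim_map r d i \<circ> word_map r d \<sigma>"
  by (simp_all add: word_map_def)

lemma word_ratio_Nil [simp]: "word_ratio r [] = 1"
  and word_ratio_Cons [simp]: "word_ratio r (i # \<sigma>) = r i * word_ratio r \<sigma>"
  and word_ratio_append [simp]: "word_ratio r (\<sigma> @ \<tau>) = word_ratio r \<sigma> * word_ratio r \<tau>"
  by (simp_all add: word_ratio_def)

lemma word_map_append: "word_map r d (\<sigma> @ \<tau>) = word_map r d \<sigma> \<circ> word_map r d \<tau>"
  by (induction \<sigma>) (simp_all add: comp_assoc)

lemma word_map_affine: "word_map r d \<sigma> x = word_ratio r \<sigma> * x + word_map r d \<sigma> 0"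
proof (induction \<sigma> arbitrary: x)
  case (Cons i \<sigma>)
  from Cons[of x] show ?case
    by (simp add: sim_map_def algebra_simps)
qed simp

lemma word_map_diff: "word_map r d \<sigma> x - word_map r d \<sigma> y = word_ratio r \<sigma> * (x - y)"
  using word_map_affine[of r d \<sigma> x] word_map_affine[of r d \<sigma> y] by (simp add: algebra_simps)

text \<open>The ratio depends on the map alone, so an equality of maps turns into one of
  ratios.\<close>

lemma word_ratio_eq_diff: "word_ratio r \<sigma> = word_map r d \<sigma> 1 - word_map r d \<sigma> 0"
  by (simp add: word_map_diff)

text \<open>\<open>transition_gen\<close> ranges over all affine representations of a neighbour;
  this identifies their coefficients.\<close>

lemma affine_coeff_unique:
  fixes R a R' a' :: real
  assumes "(\<lambda>x. R * x + a) = (\<lambda>x. R' * x + a')"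
  shows "R = R'"
  using fun_cong[OF assms, of 0] fun_cong[OF assms, of 1] by simp

lemma interval_map_Icc:
  assumes "a < b"
  shows "interval_map {a..b} = (\<lambda>x. (b - a) * x + a)"
    and "inv (interval_map {a..b}) = (\<lambda>y. (y - a) / (b - a))"
proof -
  show *: "interval_map {a..b} = (\<lambda>x. (b - a) * x + a)"
    using assms by (simp add: interval_map_def)
  show "inv (interval_map {a..b}) = (\<lambda>y. (y - a) / (b - a))"
    unfolding * using assms by (intro inv_equality) auto
qed

text \<open>Take the largest element up to \<open>a\<close> and the smallest from \<open>b\<close>
  on. With \<open>a = b\<close> this encloses a single point; with a finer net interval it yields
  the parent.\<close>

lemma consecutive_around:
  fixes A :: "real set"
  assumes "finite A" "p \<in> A" "q \<in> A" "p \<le> a" "b \<le> q" "A \<inter> {a<..<b} = {}"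
  obtains a' b' where "a' \<in> A" "b' \<in> A" "p \<le> a'" "a' \<le> a" "b \<le> b'" "b' \<le> q"
    "A \<inter> {a'<..<b'} = {}"
proof -
  define L U where "L = {e \<in> A. e \<le> a}" and "U = {e \<in> A. b \<le> e}"
  have fin: "finite L" "finite U" and mem: "p \<in> L" "q \<in> U"
    using assms by (auto simp: L_def U_def)
  have "Max L \<in> L" "Min U \<in> U"
    using fin mem by (blast intro: Max_in Min_in)+
  moreover have le: "e \<le> Max L" if "e \<in> L" for e using that fin by simp
  moreover have ge: "Min U \<le> e" if "e \<in> U" for e using that fin by simp
  moreover have "A \<inter> {Max L<..<Min U} = {}"
  proof -
    have "e \<in> L \<or> e \<in> U" if "e \<in> A" for e
      using that assms(6) by (force simp: L_def U_def)
    then show ?thesis using le ge by fastforce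
  qed
  ultimately show ?thesis
    using that[of "Max L" "Min U"] mem by (auto simp: L_def U_def)
qed

locale normalized_ifs =
  fixes I :: "'i set" and r d :: "'i \<Rightarrow> real" and K :: "real set"
  assumes ifs: "similarity_ifs I r"
    and attractor: "is_attractor I r d K"
    and hull: "convex hull K = {0..1}"
begin

abbreviation "S \<equiv> word_map r d"
abbreviation "\<rho> \<equiv> word_ratio r"
abbreviation "\<Lambda> \<equiv> words_gen I r"
abbreviation "E \<equiv> endpoints_gen I r d"
abbreviation "F \<equiv> net_intervals I r d K"
abbreviation "V \<equiv> neighbour_set I r d K"
abbreviation "tg \<equiv> transition_gen I r d K"
abbreviation "G \<equiv> transition_graph I r d K"

section \<open>Ratios of words and the words of a given generation\<close>

lemma letter_ratio: "i \<in> I \<Longrightarrow> 0 < \<bar>r i\<bar>" "i \<in> I \<Longrightarrow> \<bar>r i\<bar> < 1"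
  using ifs by (auto simp: similarity_ifs_def)

lemma finite_I: "finite I" and I_nonempty: "I \<noteq> {}"
  using ifs by (auto simp: similarity_ifs_def)

lemma K_eq: "K = (\<Union>i\<in>I. sim_map r d i ` K)"
  using attractor unfolding is_attractor_def by blast+

lemma ratio_nonzero: "\<sigma> \<in> lists I \<Longrightarrow> \<rho> \<sigma> \<noteq> 0"
  using letter_ratio(1) by (induction \<sigma>) fastforce+

lemma ratio_le_1: "\<sigma> \<in> lists I \<Longrightarrow> \<bar>\<rho> \<sigma>\<bar> \<le> 1"
proof (induction \<sigma>)
  case (Cons i \<sigma>)
  then show ?case
    using letter_ratio(2)[of i] mult_mono[of "\<bar>r i\<bar>" 1 "\<bar>\<rho> \<sigma>\<bar>" 1] by (simp add: abs_mult)
qed simp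

lemma ratio_append_le:
  assumes "\<tau> \<in> lists I"
  shows "\<bar>\<rho> (\<sigma> @ \<tau>)\<bar> \<le> \<bar>\<rho> \<sigma>\<bar>"
  using mult_left_mono[OF ratio_le_1[OF assms], of "\<bar>\<rho> \<sigma>\<bar>"] by (simp add: abs_mult)

lemma butlast_in_lists: "\<sigma> \<in> lists I \<Longrightarrow> butlast \<sigma> \<in> lists I"
  by (auto dest: in_set_butlastD)

text \<open>Ratios decay geometrically: the alphabet is finite, so the largest letter ratio
  \<open>q\<close> is still below 1.\<close>

lemma long_words_small:
  assumes "0 < t"
  obtains n where "\<And>\<sigma>. \<sigma> \<in> lists I \<Longrightarrow> n \<le> length \<sigma> \<Longrightarrow> \<bar>\<rho> \<sigma>\<bar> < t"
proof -
  define q where "q = Max ((\<lambda>i. \<bar>r i\<bar>) ` I)"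
  have q: "\<bar>r i\<bar> \<le> q" if "i \<in> I" for i
    using that finite_I by (simp add: q_def)
  have "q \<in> (\<lambda>i. \<bar>r i\<bar>) ` I"
    unfolding q_def using finite_I I_nonempty by (intro Max_in) auto
  then have "0 < q" "q < 1"
    using letter_ratio by auto
  have pow: "\<bar>\<rho> \<sigma>\<bar> \<le> q ^ length \<sigma>" if "\<sigma> \<in> lists I" for \<sigma>
    using that by (induction \<sigma>) (auto simp: abs_mult intro!: mult_mono q less_imp_le[OF \<open>0 < q\<close>])
  obtain n where n: "q ^ n < t"
    using real_arch_pow_inv[OF assms \<open>q < 1\<close>] by blast
  show ?thesis
  proof
    fix \<sigma> assume "\<sigma> \<in> lists I" "n \<le> length \<sigma>"
    then show "\<bar>\<rho> \<sigma>\<bar> < t"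
      using pow[of \<sigma>] n power_decreasing[of n "length \<sigma>" q] \<open>0 < q\<close> \<open>q < 1\<close> by linarith
  qed
qed

text \<open>Every transition generation is the ratio of a word, so this finiteness makes the descent
  through successive children stop.\<close>

lemma finite_words_ratio_ge:
  assumes "0 < t"
  shows "finite {\<sigma> \<in> lists I. t \<le> \<bar>\<rho> \<sigma>\<bar>}"
proof -
  obtain n where n: "\<And>\<sigma>. \<sigma> \<in> lists I \<Longrightarrow> n \<le> length \<sigma> \<Longrightarrow> \<bar>\<rho> \<sigma>\<bar> < t"
    using long_words_small[OF assms] by blast
  have "{\<sigma> \<in> lists I. t \<le> \<bar>\<rho> \<sigma>\<bar>} \<subseteq> {\<sigma>. set \<sigma> \<subseteq> I \<and> length \<sigma> \<le> n}"
    using n by (force simp: not_le)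
  then show ?thesis
    using finite_lists_length_le[OF finite_I] finite_subset by blast
qed

lemma finite_words_gen:
  assumes "0 < t"
  shows "finite (\<Lambda> t)"
proof -
  obtain n where n: "\<And>\<sigma>. \<sigma> \<in> lists I \<Longrightarrow> n \<le> length \<sigma> \<Longrightarrow> \<bar>\<rho> \<sigma>\<bar> < t"
    using long_words_small[OF assms] by blast
  have "\<Lambda> t \<subseteq> {\<sigma>. set \<sigma> \<subseteq> I \<and> length \<sigma> \<le> n}"
  proof
    fix \<sigma> assume *: "\<sigma> \<in> \<Lambda> t"
    have "length \<sigma> \<le> n"
    proof (rule ccontr)
      assume "\<not> length \<sigma> \<le> n"
      then have "n \<le> length (butlast \<sigma>)" "\<sigma> \<noteq> []" by auto
      then show False
        using * n[of "butlast \<sigma>"] butlast_in_lists[of \<sigma>] by (auto simp: words_gen_def)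
    qed
    then show "\<sigma> \<in> {\<sigma>. set \<sigma> \<subseteq> I \<and> length \<sigma> \<le> n}"
      using * by (auto simp: words_gen_def)
  qed
  then show ?thesis
    using finite_lists_length_le[OF finite_I] finite_subset by blast
qed

lemma finite_endpoints: "0 < t \<Longrightarrow> finite (E t)"
  by (simp add: endpoints_gen_def finite_words_gen)

lemma words_genD:
  assumes "\<sigma> \<in> \<Lambda> t"
  shows "\<sigma> \<in> lists I" "\<bar>\<rho> \<sigma>\<bar> < t" "\<sigma> \<noteq> [] \<Longrightarrow> t \<le> \<bar>\<rho> (butlast \<sigma>)\<bar>"
  using assms by (auto simp: words_gen_def)

text \<open>Cut the word at its first prefix of ratio below \<open>t\<close>; the induction drops
  letters from the end until it is found.\<close>

lemma prefix_in_words_gen: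
  assumes "\<sigma> \<in> lists I" "\<bar>\<rho> \<sigma>\<bar> < t"
  obtains u v where "\<sigma> = u @ v" "u \<in> \<Lambda> t" "v \<in> lists I"
proof -
  have "\<exists>u v. \<sigma> = u @ v \<and> u \<in> \<Lambda> t"
    using assms
  proof (induction \<sigma> rule: rev_induct)
    case Nil
    then show ?case by (auto simp: words_gen_def)
  next
    case (snoc i \<sigma>)
    show ?case
    proof (cases "\<bar>\<rho> \<sigma>\<bar> < t")
      case True
      with snoc show ?thesis by (metis append_assoc append_in_lists_conv)
    next
      case False
      then have "\<sigma> @ [i] \<in> \<Lambda> t"
        using snoc.prems by (simp add: words_gen_def)
      then show ?thesis by blast
    qed
  qed
  then obtain u v where "\<sigma> = u @ v" "u \<in> \<Lambda> t" by blast
  then show ?thesis using that assms(1) by simp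
qed

text \<open>If \<open>\<tau>\<close> were non-empty, \<open>\<sigma>\<close> would be a prefix of
  the predecessor of \<open>\<sigma> @ \<tau>\<close>, whose ratio would then already be below
  \<open>t\<close>.\<close>

lemma words_gen_antichain:
  assumes "\<sigma> \<in> \<Lambda> t" "\<sigma> @ \<tau> \<in> \<Lambda> t"
  shows "\<tau> = []"
proof (rule ccontr)
  assume "\<tau> \<noteq> []"
  have "butlast \<tau> \<in> lists I"
    using words_genD(1)[OF assms(2)] butlast_in_lists[of \<tau>] by auto
  then have "\<bar>\<rho> (butlast (\<sigma> @ \<tau>))\<bar> \<le> \<bar>\<rho> \<sigma>\<bar>"
    using \<open>\<tau> \<noteq> []\<close> ratio_append_le[of "butlast \<tau>" \<sigma>] by (simp add: butlast_append)
  then show False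
    using words_genD(2)[OF assms(1)] words_genD(3)[OF assms(2)] \<open>\<tau> \<noteq> []\<close> by simp
qed

section \<open>The attractor\<close>

lemma K_subset: "K \<subseteq> {0..1}"
  using hull_subset[of K convex] hull by simp

text \<open>Otherwise \<open>K\<close> lies in a half-open interval, which is convex, so the hull of
  \<open>K\<close> would miss 0. The same works for 1.\<close>

lemma zero_in_K: "0 \<in> K"
proof (rule ccontr)
  assume "0 \<notin> K"
  then have "K \<subseteq> {0<..1}" using K_subset by (force simp: less_le)
  then have "convex hull K \<subseteq> {0<..1}" by (intro hull_minimal) simp_all
  moreover have "0 \<in> convex hull K" using hull by simp
  ultimately show False by auto
qed

lemma one_in_K: "1 \<in> K"
proof (rule ccontr)
  assume "1 \<notin> K"
  then have "K \<subseteq> {0..<1}" using K_subset by (force simp: less_le)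
  then have "convex hull K \<subseteq> {0..<1}" by (intro hull_minimal) simp_all
  moreover have "1 \<in> convex hull K" using hull by simp
  ultimately show False by auto
qed

lemma sim_map_K: "i \<in> I \<Longrightarrow> x \<in> K \<Longrightarrow> sim_map r d i x \<in> K"
  using K_eq by blast

lemma word_map_K: "\<sigma> \<in> lists I \<Longrightarrow> x \<in> K \<Longrightarrow> S \<sigma> x \<in> K"
  by (induction \<sigma>) (auto intro: sim_map_K)

lemma word_map_between:
  assumes "x \<in> {0..1}"
  shows "min (S \<sigma> 0) (S \<sigma> 1) \<le> S \<sigma> x" "S \<sigma> x \<le> max (S \<sigma> 0) (S \<sigma> 1)"
proof -
  \<comment> \<open>The convex combination avoids a case split on the sign of the ratio.\<close>
  have "S \<sigma> x = (1 - x) * S \<sigma> 0 + x * S \<sigma> 1"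
    using word_map_affine[of r d \<sigma> x] word_ratio_eq_diff[of r \<sigma> d] by (simp add: algebra_simps)
  moreover have "(1 - x) * m + x * m = m" for m by (simp add: algebra_simps)
  moreover have "(1 - x) * u + x * v \<le> (1 - x) * u' + x * v'" if "u \<le> u'" "v \<le> v'" for u u' v v'
    using that assms by (intro add_mono mult_left_mono) auto
  ultimately show "min (S \<sigma> 0) (S \<sigma> 1) \<le> S \<sigma> x" "S \<sigma> x \<le> max (S \<sigma> 0) (S \<sigma> 1)"
    by (metis min.cobounded1 min.cobounded2, metis max.cobounded1 max.cobounded2)
qed

lemma word_map_unit:
  assumes "\<sigma> \<in> lists I" "x \<in> {0..1}"
  shows "S \<sigma> x \<in> {0..1}"
proof -
  have "S \<sigma> 0 \<in> {0..1}" "S \<sigma> 1 \<in> {0..1}"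
    using K_subset word_map_K[OF assms(1)] zero_in_K one_in_K by blast+
  then show ?thesis using word_map_between[OF assms(2), of \<sigma>] by auto
qed

lemma word_covering:
  assumes "x \<in> K"
  obtains \<sigma> y where "\<sigma> \<in> lists I" "length \<sigma> = n" "y \<in> K" "S \<sigma> y = x"
proof -
  have "\<exists>\<sigma> y. \<sigma> \<in> lists I \<and> length \<sigma> = n \<and> y \<in> K \<and> S \<sigma> y = x"
    using assms
  proof (induction n arbitrary: x)
    case 0
    then show ?case by auto
  next
    case (Suc n)
    obtain i y where iy: "i \<in> I" "y \<in> K" "x = sim_map r d i y"
      using Suc.prems K_eq by blast
    then obtain \<sigma> z where "\<sigma> \<in> lists I" "length \<sigma> = n" "z \<in> K" "S \<sigma> z = y"
      using Suc.IH by blast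
    then have "i # \<sigma> \<in> lists I \<and> length (i # \<sigma>) = Suc n \<and> z \<in> K \<and> S (i # \<sigma>) z = x"
      using iy by simp
    then show ?case by blast
  qed
  then show ?thesis using that by blast
qed

text \<open>A point of \<open>K\<close> has codes of every length; a long code has a prefix in
  \<open>\<Lambda> t\<close>, and the piece of the prefix still contains the point.\<close>

lemma words_gen_covering:
  assumes "x \<in> K" "0 < t"
  obtains \<sigma> where "\<sigma> \<in> \<Lambda> t" "x \<in> S \<sigma> ` K"
proof -
  obtain n where n: "\<And>\<sigma>. \<sigma> \<in> lists I \<Longrightarrow> n \<le> length \<sigma> \<Longrightarrow> \<bar>\<rho> \<sigma>\<bar> < t"
    using long_words_small[OF assms(2)] by blast
  obtain \<sigma> y where \<sigma>: "\<sigma> \<in> lists I" "length \<sigma> = n" "y \<in> K" "S \<sigma> y = x"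
    using word_covering[OF assms(1)] by metis
  then obtain u v where "\<sigma> = u @ v" "u \<in> \<Lambda> t" "v \<in> lists I"
    using prefix_in_words_gen[of \<sigma> t] n[of \<sigma>] by blast
  then show ?thesis
    using that[of u] \<sigma> word_map_K[of v y] by (auto simp: word_map_append)
qed

text \<open>A closest pair of points of a finite set with at least two points would be moved
  closer together by any of the contractions.\<close>

lemma infinite_K: "infinite K"
proof
  assume fin: "finite K"
  define D where "D = {\<bar>x - y\<bar> | x y. x \<in> K \<and> y \<in> K \<and> x \<noteq> y}"
  have "D \<subseteq> (\<lambda>(x, y). \<bar>x - y\<bar>) ` (K \<times> K)" by (auto simp: D_def)
  then have finD: "finite D" using fin finite_subset by blast
  have "\<bar>0 - 1\<bar> \<in> D" unfolding D_def using zero_in_K one_in_K zero_neq_one by blast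
  then have "Min D \<in> D" using finD by (intro Min_in) auto
  then obtain x y where xy: "x \<in> K" "y \<in> K" "x \<noteq> y" "Min D = \<bar>x - y\<bar>" by (auto simp: D_def)
  obtain i where i: "i \<in> I" using I_nonempty by blast
  have diff: "sim_map r d i x - sim_map r d i y = r i * (x - y)"
    by (simp add: sim_map_def algebra_simps)
  have "sim_map r d i x \<noteq> sim_map r d i y"
    using diff letter_ratio(1)[OF i] xy(3) by auto
  then have "\<bar>sim_map r d i x - sim_map r d i y\<bar> \<in> D"
    using sim_map_K[OF i] xy by (auto simp: D_def)
  then have "\<bar>x - y\<bar> \<le> \<bar>r i\<bar> * \<bar>x - y\<bar>"
    using Min_le[OF finD] xy(4) diff by (simp add: abs_mult)
  then show False
    using letter_ratio(2)[OF i] xy(3) by simp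
qed

section \<open>Net intervals\<close>

lemma endpoints_subset_K: "E t \<subseteq> K"
  using words_genD(1) word_map_K zero_in_K one_in_K by (auto simp: endpoints_gen_def)

lemma endpointE:
  assumes "p \<in> E t"
  obtains \<sigma> e where "\<sigma> \<in> \<Lambda> t" "e \<in> {0, 1}" "p = S \<sigma> e"
proof -
  obtain \<sigma> where "\<sigma> \<in> \<Lambda> t" "p = S \<sigma> 0 \<or> p = S \<sigma> 1"
    using assms by (auto simp: endpoints_gen_def)
  then show ?thesis using that[of \<sigma> 0] that[of \<sigma> 1] by blast
qed

text \<open>The point \<open>e\<close> of \<open>K\<close> has a preimage \<open>y\<close> under
  some letter, so \<open>e\<close> is a mean, with weights \<open>1 - y\<close> and
  \<open>y\<close>, of the images of 0 and 1. These lie in the unit interval, of which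
  \<open>e\<close> is an extreme point, so an image with non-zero weight equals
  \<open>e\<close>.\<close>

lemma extreme_point_lift:
  assumes "e \<in> {0, 1}"
  obtains i e' where "i \<in> I" "e' \<in> {0, 1}" "sim_map r d i e' = e"
proof -
  obtain i y where i: "i \<in> I" and y: "y \<in> K" "sim_map r d i y = e"
  proof -
    have "e \<in> (\<Union>i\<in>I. sim_map r d i ` K)"
      using assms zero_in_K one_in_K K_eq[symmetric] by auto
    then show ?thesis using that by blast
  qed
  have "S [i] 0 \<in> {0..1}" "S [i] 1 \<in> {0..1}"
    using word_map_unit[of "[i]"] i by auto
  then have ends: "0 \<le> d i" "d i \<le> 1" "0 \<le> r i + d i" "r i + d i \<le> 1"
    by (auto simp: sim_map_def)
  have y01: "0 \<le> y" "y \<le> 1" using y K_subset by auto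
  have eq: "(1 - y) * d i + y * (r i + d i) = e"
    using y(2) by (simp add: sim_map_def algebra_simps)
  have "sim_map r d i 0 = e \<or> sim_map r d i 1 = e"
  proof (rule ccontr)
    assume no: "\<not> ?thesis"
    consider "e = 0" | "e = 1" using assms by auto
    then show False
    proof cases
      case 1
      then have "(1 - y) * d i = 0 \<and> y * (r i + d i) = 0"
        using eq y01 ends by (simp add: add_nonneg_eq_0_iff)
      then show False using no 1 by (auto simp: sim_map_def)
    next
      case 2
      have "(1 - y) * (1 - d i) + y * (1 - (r i + d i)) = 0"
        using eq 2 by (simp add: algebra_simps)
      then have "(1 - y) * (1 - d i) = 0 \<and> y * (1 - (r i + d i)) = 0"
        using y01 ends by (simp add: add_nonneg_eq_0_iff)
      then show False using no 2 by (auto simp: sim_map_def)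
    qed
  qed
  then show ?thesis using that i by blast
qed

text \<open>While the ratio of \<open>\<sigma>\<close> is at least \<open>s\<close>,
  \<open>extreme_point_lift\<close> rewrites the same point as the image of 0 or 1 under a word one
  letter longer. This ends with a word of \<open>\<Lambda> s\<close>, at the latest at length
  \<open>n\<close>. Hence endpoints persist in finer generations.\<close>

lemma endpoint_refine:
  assumes "\<sigma> \<in> lists I" "\<sigma> = [] \<or> s \<le> \<bar>\<rho> (butlast \<sigma>)\<bar>" "e \<in> {0, 1}" "0 < s"
  shows "S \<sigma> e \<in> E s"
proof -
  obtain n where n: "\<And>\<sigma>. \<sigma> \<in> lists I \<Longrightarrow> n \<le> length \<sigma> \<Longrightarrow> \<bar>\<rho> \<sigma>\<bar> < s"
    using long_words_small[OF assms(4)] by blast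
  show ?thesis
    using assms(1-3)
  proof (induction "n - length \<sigma>" arbitrary: \<sigma> e rule: less_induct)
    case less
    show ?case
    proof (cases "\<bar>\<rho> \<sigma>\<bar> < s")
      case True
      then have "\<sigma> \<in> \<Lambda> s" using less.prems by (auto simp: words_gen_def)
      then show ?thesis using less.prems(3) by (auto simp: endpoints_gen_def)
    next
      case False
      obtain i e' where i: "i \<in> I" "e' \<in> {0, 1}" "sim_map r d i e' = e"
        using extreme_point_lift[OF less.prems(3)] by blast
      have "S (\<sigma> @ [i]) e' \<in> E s"
      proof (rule less.hyps)
        show "n - length (\<sigma> @ [i]) < n - length \<sigma>"
          using False n[of \<sigma>] less.prems(1) by force
      qed (use i False less.prems(1) in auto)
      then show ?thesis using i by (simp add: word_map_append)
    qed
  qed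
qed

lemma endpoints_mono:
  assumes "0 < s" "s \<le> t"
  shows "E t \<subseteq> E s"
proof -
  have "S \<sigma> e \<in> E s" if "\<sigma> \<in> \<Lambda> t" "e \<in> {0, 1}" for \<sigma> e
  proof (rule endpoint_refine)
    show "\<sigma> = [] \<or> s \<le> \<bar>\<rho> (butlast \<sigma>)\<bar>" using words_genD(3)[OF that(1)] assms(2) by force
  qed (use words_genD(1)[OF that(1)] assms(1) that(2) in auto)
  then show ?thesis by (auto simp: endpoints_gen_def)
qed

lemma zero_one_endpoints:
  assumes "0 < s"
  shows "0 \<in> E s" "1 \<in> E s"
  using endpoint_refine[of "[]" s 0] endpoint_refine[of "[]" s 1] assms by auto

lemma net_intervalE:
  assumes "\<Delta> \<in> F t"
  obtains a b where "\<Delta> = {a..b}" "a \<in> E t" "b \<in> E t" "a < b"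
    "E t \<inter> {a<..<b} = {}" "{a<..<b} \<inter> K \<noteq> {}"
  using assms unfolding net_intervals_def by auto

lemma net_intervalI:
  "a \<in> E t \<Longrightarrow> b \<in> E t \<Longrightarrow> a < b \<Longrightarrow> E t \<inter> {a<..<b} = {} \<Longrightarrow> {a<..<b} \<inter> K \<noteq> {} \<Longrightarrow> {a..b} \<in> F t"
  unfolding net_intervals_def by blast

text \<open>Endpoints of generation \<open>t\<close> are also endpoints of generation
  \<open>s\<close>, so none lies inside \<open>\<Delta>'\<close>; the nearest ones on both sides
  bound the parent, and 0 and 1 ensure that they exist.\<close>

lemma net_interval_parent:
  assumes "0 < s" "s \<le> t" "\<Delta>' \<in> F s"
  obtains \<Delta> where "\<Delta> \<in> F t" "\<Delta>' \<subseteq> \<Delta>"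
proof -
  obtain a' b' where ab': "\<Delta>' = {a'..b'}" "a' \<in> E s" "b' \<in> E s" "a' < b'"
    "E s \<inter> {a'<..<b'} = {}" "{a'<..<b'} \<inter> K \<noteq> {}"
    using net_intervalE[OF assms(3)] by metis
  have "a' \<in> {0..1}" "b' \<in> {0..1}" using ab'(2,3) endpoints_subset_K K_subset by blast+
  then have "0 \<le> a'" "b' \<le> 1" by simp_all
  moreover have "E t \<inter> {a'<..<b'} = {}" using ab' endpoints_mono[OF assms(1,2)] by blast
  ultimately obtain a b where ab: "a \<in> E t" "b \<in> E t" "a \<le> a'" "b' \<le> b" "E t \<inter> {a<..<b} = {}"
    using consecutive_around[of "E t" 0 1 a' b'] finite_endpoints zero_one_endpoints assms(1,2)
    by (metis less_le_trans)
  have "{a'<..<b'} \<subseteq> {a<..<b}" using ab by auto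
  then have "{a<..<b} \<inter> K \<noteq> {}" using ab' by blast
  then have "{a..b} \<in> F t" using ab ab' by (intro net_intervalI) auto
  then show ?thesis using that[of "{a..b}"] ab ab' by auto
qed

text \<open>\<open>\<Delta>''\<close> only witnesses that \<open>\<Delta>\<close> and
  \<open>\<Delta>'\<close> overlap in more than a point. The ends of \<open>\<Delta>\<close> are
  endpoints of generation \<open>s\<close> and avoid the inside of \<open>\<Delta>'\<close>, so
  overlap becomes inclusion.\<close>

lemma net_interval_nested:
  assumes "0 < s" "s \<le> t" "\<Delta>' \<in> F s" "\<Delta> \<in> F t" "\<Delta>'' \<in> F u" "\<Delta>'' \<subseteq> \<Delta>" "\<Delta>'' \<subseteq> \<Delta>'"
  shows "\<Delta>' \<subseteq> \<Delta>"
proof -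
  obtain a' b' where ab': "\<Delta>' = {a'..b'}" "E s \<inter> {a'<..<b'} = {}"
    using net_intervalE[OF assms(3)] by metis
  obtain a b where ab: "\<Delta> = {a..b}" "a \<in> E t" "b \<in> E t"
    using net_intervalE[OF assms(4)] by metis
  obtain a'' b'' where ab'': "\<Delta>'' = {a''..b''}" "a'' < b''"
    using net_intervalE[OF assms(5)] by metis
  have "a \<in> E s" "b \<in> E s" using ab endpoints_mono[OF assms(1,2)] by auto
  then have "a \<notin> {a'<..<b'}" "b \<notin> {a'<..<b'}" using ab' by auto
  moreover have "a \<le> a''" "b'' \<le> b" "a' \<le> a''" "b'' \<le> b'"
    using assms(6,7) ab ab' ab'' by auto
  ultimately show ?thesis using ab ab' ab''(2) by auto
qed

section \<open>Neighbour sets and the transition generation\<close>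

definition neighbour_words :: "real \<Rightarrow> real set \<Rightarrow> 'i list set" where
  "neighbour_words t \<Delta> = {\<sigma> \<in> \<Lambda> t. S \<sigma> ` K \<inter> interior \<Delta> \<noteq> {}}"

text \<open>Words, unlike maps, have prefixes, so generations can be compared by the antichain
  property.\<close>

lemma neighbour_set_eq: "V t \<Delta> = (\<lambda>\<sigma>. inv (interval_map \<Delta>) \<circ> S \<sigma>) ` neighbour_words t \<Delta>"
  by (auto simp: neighbour_set_def neighbour_words_def)

lemma neighbour_setE:
  assumes "g \<in> V t {a..b}"
  obtains \<sigma> z where "\<sigma> \<in> \<Lambda> t" "z \<in> K" "a < S \<sigma> z" "S \<sigma> z < b"
    "g = inv (interval_map {a..b}) \<circ> S \<sigma>"
proof -
  obtain \<sigma> where \<sigma>: "\<sigma> \<in> \<Lambda> t" "S \<sigma> ` K \<inter> {a<..<b} \<noteq> {}"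
    "g = inv (interval_map {a..b}) \<circ> S \<sigma>"
    using assms unfolding neighbour_set_eq neighbour_words_def interior_atLeastAtMost_real by blast
  from \<sigma>(2) obtain z where "z \<in> K" "a < S \<sigma> z" "S \<sigma> z < b" by auto
  then show ?thesis using that \<sigma>(1,3) by blast
qed

text \<open>The factor \<open>diameter \<Delta>\<close> cancels the normalization of the neighbours,
  which leaves the largest ratio of a neighbour word.\<close>

lemma transition_gen_eq:
  assumes "0 < t" "\<Delta> \<in> F t"
  shows "\<exists>\<sigma>\<in>neighbour_words t \<Delta>. tg t \<Delta> = \<bar>\<rho> \<sigma>\<bar>"
    and "\<And>\<sigma>. \<sigma> \<in> neighbour_words t \<Delta> \<Longrightarrow> \<bar>\<rho> \<sigma>\<bar> \<le> tg t \<Delta>"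
proof -
  obtain a b where ab: "\<Delta> = {a..b}" "a < b" "{a<..<b} \<inter> K \<noteq> {}"
    using net_intervalE[OF assms(2)] by metis
  define A where "A = {\<bar>R\<bar> | R c. (\<lambda>x. R * x + c) \<in> V t \<Delta>}"
  have form: "inv (interval_map \<Delta>) \<circ> S \<sigma> = (\<lambda>x. \<rho> \<sigma> / (b - a) * x + (S \<sigma> 0 - a) / (b - a))" for \<sigma>
  proof
    fix x
    have "(inv (interval_map \<Delta>) \<circ> S \<sigma>) x = (\<rho> \<sigma> * x + S \<sigma> 0 - a) / (b - a)"
      using ab interval_map_Icc(2)[of a b] word_map_affine[of r d \<sigma> x] by simp
    also have "\<dots> = \<rho> \<sigma> / (b - a) * x + (S \<sigma> 0 - a) / (b - a)"
      by (simp add: add_divide_distrib diff_divide_distrib)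
    finally show "(inv (interval_map \<Delta>) \<circ> S \<sigma>) x = \<rho> \<sigma> / (b - a) * x + (S \<sigma> 0 - a) / (b - a)" .
  qed
  have A: "A = (\<lambda>\<sigma>. \<bar>\<rho> \<sigma>\<bar> / (b - a)) ` neighbour_words t \<Delta>"
  proof (intro equalityI subsetI)
    fix y assume "y \<in> A"
    then obtain R c \<sigma> where "y = \<bar>R\<bar>" "\<sigma> \<in> neighbour_words t \<Delta>"
      "(\<lambda>x. R * x + c) = inv (interval_map \<Delta>) \<circ> S \<sigma>"
      unfolding A_def neighbour_set_eq by auto
    then show "y \<in> (\<lambda>\<sigma>. \<bar>\<rho> \<sigma>\<bar> / (b - a)) ` neighbour_words t \<Delta>"
      unfolding form using affine_coeff_unique ab(2) by fastforce
  next
    fix y assume "y \<in> (\<lambda>\<sigma>. \<bar>\<rho> \<sigma>\<bar> / (b - a)) ` neighbour_words t \<Delta>"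
    then obtain \<sigma> where \<sigma>: "\<sigma> \<in> neighbour_words t \<Delta>" "y = \<bar>\<rho> \<sigma> / (b - a)\<bar>"
      using ab(2) by auto
    then have "(\<lambda>x. \<rho> \<sigma> / (b - a) * x + (S \<sigma> 0 - a) / (b - a)) \<in> V t \<Delta>"
      unfolding neighbour_set_eq form[symmetric] by blast
    then show "y \<in> A" unfolding A_def using \<sigma> by blast
  qed
  \<comment> \<open>\<open>Max\<close> is meaningful only on a non-empty set: a point of
    \<open>K\<close> inside the net interval is covered by some word of generation
    \<open>t\<close>.\<close>
  have "interior \<Delta> = {a<..<b}" using ab by simp
  then obtain x where "x \<in> K" "x \<in> interior \<Delta>" using ab(3) by blast
  obtain \<sigma> where "\<sigma> \<in> \<Lambda> t" "x \<in> S \<sigma> ` K"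
    using words_gen_covering[OF \<open>x \<in> K\<close> assms(1)] by blast
  with \<open>x \<in> interior \<Delta>\<close> have "\<sigma> \<in> neighbour_words t \<Delta>"
    unfolding neighbour_words_def by blast
  then have ne: "A \<noteq> {}" using A by blast
  have fin: "finite A"
    unfolding A neighbour_words_def using finite_words_gen[OF assms(1)] by simp
  have tg: "tg t \<Delta> = (b - a) * Max A"
    using ab by (simp add: transition_gen_def A_def)
  show "\<exists>\<sigma>\<in>neighbour_words t \<Delta>. tg t \<Delta> = \<bar>\<rho> \<sigma>\<bar>"
    using Max_in[OF fin ne] tg ab(2) unfolding A by auto
  fix \<sigma> assume "\<sigma> \<in> neighbour_words t \<Delta>"
  then have "\<bar>\<rho> \<sigma>\<bar> / (b - a) \<le> Max A" using fin unfolding A by (intro Max_ge) auto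
  then show "\<bar>\<rho> \<sigma>\<bar> \<le> tg t \<Delta>"
    unfolding tg using ab(2) by (simp add: pos_divide_le_eq mult.commute)
qed

lemma transition_gen_bounds:
  assumes "0 < t" "\<Delta> \<in> F t"
  shows "0 < tg t \<Delta>" "tg t \<Delta> < t"
  using transition_gen_eq(1)[OF assms] words_genD ratio_nonzero
  by (fastforce simp: neighbour_words_def)+

text \<open>Neighbour words of generation \<open>t\<close> have ratio at most
  \<open>tg t \<Delta>\<close>, so they already belong to \<open>\<Lambda> s\<close>. A neighbour
  word of generation \<open>s\<close> extends one of generation \<open>t\<close>, and the antichain
  property makes the two equal.\<close>

lemma net_interval_stable:
  assumes "0 < t" "\<Delta> \<in> F t" "tg t \<Delta> < s" "s \<le> t"
  shows "neighbour_words s \<Delta> = neighbour_words t \<Delta>" "\<Delta> \<in> F s" "V s \<Delta> = V t \<Delta>"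
proof -
  obtain a b where ab: "\<Delta> = {a..b}" "a \<in> E t" "b \<in> E t" "a < b"
    "E t \<inter> {a<..<b} = {}" "{a<..<b} \<inter> K \<noteq> {}"
    using net_intervalE[OF assms(2)] by metis
  have s: "0 < s" using transition_gen_bounds(1)[OF assms(1,2)] assms(3) by simp
  have sub: "\<sigma> \<in> \<Lambda> s" if "\<sigma> \<in> neighbour_words t \<Delta>" for \<sigma>
    using that transition_gen_eq(2)[OF assms(1,2) that] assms(3,4)
    by (auto simp: neighbour_words_def words_gen_def)
  have "\<tau> \<in> neighbour_words t \<Delta>" if \<tau>: "\<tau> \<in> neighbour_words s \<Delta>" for \<tau>
  proof -
    have \<tau>': "\<tau> \<in> \<Lambda> s" "S \<tau> ` K \<inter> interior \<Delta> \<noteq> {}"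
      using \<tau> by (auto simp: neighbour_words_def)
    then obtain u v where uv: "\<tau> = u @ v" "u \<in> \<Lambda> t" "v \<in> lists I"
      using prefix_in_words_gen[of \<tau> t] words_genD[of \<tau> s] assms(4) by (metis less_le_trans)
    have "S \<tau> ` K \<subseteq> S u ` K"
      using uv word_map_K by (auto simp: word_map_append)
    then have u: "u \<in> neighbour_words t \<Delta>"
      using uv \<tau>' by (auto simp: neighbour_words_def)
    then have "v = []" using words_gen_antichain[OF sub[OF u]] \<tau>' uv by blast
    then show ?thesis using u uv by simp
  qed
  then show eq: "neighbour_words s \<Delta> = neighbour_words t \<Delta>"
    using sub by (auto simp: neighbour_words_def)
  then show "V s \<Delta> = V t \<Delta>" by (simp add: neighbour_set_eq)
  have "E s \<inter> {a<..<b} = {}"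
  proof (rule ccontr)
    \<comment> \<open>Since 0 and 1 lie in \<open>K\<close>, the word of a new endpoint inside would
      be a neighbour word, hence of generation \<open>t\<close>.\<close>
    assume "E s \<inter> {a<..<b} \<noteq> {}"
    then obtain \<sigma> e where \<sigma>: "\<sigma> \<in> \<Lambda> s" "e \<in> {0, 1}" "S \<sigma> e \<in> {a<..<b}"
      using endpointE by (metis IntE ex_in_conv)
    then have "\<sigma> \<in> neighbour_words s \<Delta>"
      using zero_in_K one_in_K ab(1) by (auto simp: neighbour_words_def)
    then have "\<sigma> \<in> \<Lambda> t" unfolding eq by (simp add: neighbour_words_def)
    then have "S \<sigma> e \<in> E t" using \<sigma>(2) by (auto simp: endpoints_gen_def)
    then show False using \<sigma>(3) ab by blast
  qed
  then show "\<Delta> \<in> F s"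
    using ab endpoints_mono[OF s assms(4)] by (auto intro: net_intervalI)
qed

section \<open>Paths along nested net intervals\<close>

sublocale graph: wf_digraph G
proof
  fix e assume "e \<in> arcs G"
  then obtain t \<Delta> \<Delta>' where e: "0 < t" "\<Delta> \<in> F t" "\<Delta>' \<in> children I r d K t \<Delta>"
    "e = (V t \<Delta>, V (tg t \<Delta>) \<Delta>', position_index \<Delta> \<Delta>')"
    by (auto simp: transition_graph_def)
  then show "tail G e \<in> verts G" by (auto simp: transition_graph_def)
  have "0 < tg t \<Delta>" "\<Delta>' \<in> F (tg t \<Delta>)"
    using e transition_gen_bounds(1) by (auto simp: children_def)
  then show "head G e \<in> verts G" using e(4) by (auto simp: transition_graph_def)
qed

lemma path_to_child:
  assumes "0 < t" "\<Delta> \<in> F t" "\<Delta>' \<in> children I r d K t \<Delta>"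
  shows "path_from_to G (V t \<Delta>) (V (tg t \<Delta>) \<Delta>')"
proof -
  have arc: "(V t \<Delta>, V (tg t \<Delta>) \<Delta>', position_index \<Delta> \<Delta>') \<in> arcs G" (is "?e \<in> _")
    using assms by (auto simp: transition_graph_def)
  from graph.arc_implies_awalk[OF this]
  have "pre_digraph.awalk G (V t \<Delta>) [?e] (V (tg t \<Delta>) \<Delta>')"
    by (simp add: transition_graph_def)
  then show ?thesis unfolding path_from_to_def by blast
qed

text \<open>Step to the child \<open>\<Delta>1\<close> that contains \<open>\<Delta>'\<close>. If
  its transition generation is still at least \<open>s\<close>, repeat; otherwise
  \<open>\<Delta>1\<close> survives unchanged to generation \<open>s\<close> and is
  \<open>\<Delta>'\<close>. The measure counts the words with ratio between \<open>s\<close> and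
  \<open>t\<close>.\<close>

lemma path_to_descendant:
  assumes "0 < s" "\<Delta>' \<in> F s" "0 < t" "\<Delta> \<in> F t" "\<Delta>' \<subseteq> \<Delta>" "s \<le> tg t \<Delta>"
  shows "path_from_to G (V t \<Delta>) (V s \<Delta>')"
  using assms(3-6)
proof (induction "card {\<sigma> \<in> lists I. s \<le> \<bar>\<rho> \<sigma>\<bar> \<and> \<bar>\<rho> \<sigma>\<bar> < t}" arbitrary: t \<Delta> rule: less_induct)
  case less
  let ?u = "tg t \<Delta>"
  have u: "0 < ?u" "?u < t" using transition_gen_bounds less.prems by auto
  obtain \<Delta>1 where \<Delta>1: "\<Delta>1 \<in> F ?u" "\<Delta>' \<subseteq> \<Delta>1"
    using net_interval_parent[OF assms(1) less.prems(4) assms(2)] by blast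
  have "\<Delta>1 \<subseteq> \<Delta>"
    using net_interval_nested[OF u(1) _ \<Delta>1(1) less.prems(2) assms(2)] u(2) less.prems(3) \<Delta>1(2)
    by simp
  then have "\<Delta>1 \<in> children I r d K t \<Delta>" using \<Delta>1 by (simp add: children_def)
  then have step: "path_from_to G (V t \<Delta>) (V ?u \<Delta>1)"
    using path_to_child less.prems by blast
  show ?case
  proof (cases "s \<le> tg ?u \<Delta>1")
    case True
    obtain \<sigma> where \<sigma>: "\<sigma> \<in> lists I" "?u = \<bar>\<rho> \<sigma>\<bar>"
      using transition_gen_eq(1)[OF less.prems(1,2)] words_genD(1) by (auto simp: neighbour_words_def)
    let ?B = "\<lambda>t. {\<sigma> \<in> lists I. s \<le> \<bar>\<rho> \<sigma>\<bar> \<and> \<bar>\<rho> \<sigma>\<bar> < t}"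
    \<comment> \<open>The word whose ratio is exactly \<open>?u\<close> leaves the count, so the
      measure drops.\<close>
    have "\<sigma> \<in> ?B t" "\<sigma> \<notin> ?B ?u" "?B ?u \<subseteq> ?B t"
      using \<sigma> u less.prems(4) by auto
    moreover have "finite (?B t)"
      using finite_words_ratio_ge[OF assms(1)] by (rule finite_subset[rotated]) auto
    ultimately have "card (?B ?u) < card (?B t)"
      by (intro psubset_card_mono) auto
    from less.hyps[OF this u(1) \<Delta>1 True] step show ?thesis
      unfolding graph.path_from_to_iff by (rule trancl_trans[rotated])
  next
    case False
    then have "tg ?u \<Delta>1 < s" by simp
    note st = net_interval_stable(2,3)[OF u(1) \<Delta>1(1) this less.prems(4)]
    \<comment> \<open>Both are now net intervals of generation \<open>s\<close>, and overlapping
      ones coincide.\<close>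
    have "\<Delta>1 \<subseteq> \<Delta>'"
      using net_interval_nested[OF assms(1) order_refl st(1) assms(2) assms(2)] \<Delta>1(2) by simp
    then have "\<Delta>1 = \<Delta>'" using \<Delta>1(2) by simp
    then show ?thesis using step st(2) by simp
  qed
qed


section \<open>Saturated balls\<close>

lemma word_map_less_iff: "0 < \<rho> \<omega> \<Longrightarrow> S \<omega> x < S \<omega> y \<longleftrightarrow> x < y"
  using word_map_diff[of r d \<omega> y x] by (metis diff_gt_0_iff_gt zero_less_mult_iff not_less_iff_gr_or_eq)

lemma inj_word_map:
  assumes "\<sigma> \<in> lists I"
  shows "inj (S \<sigma>)"
proof (rule injI)
  fix x y assume "S \<sigma> x = S \<sigma> y"
  then show "x = y" using word_map_diff[of r d \<sigma> x y] ratio_nonzero[OF assms] by simp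
qed

text \<open>Neighbour sets see orientation, so only words with positive ratio copy them; a
  negative ratio is corrected by appending a reflecting letter.\<close>

lemma positive_word_inside:
  assumes "y \<in> K" "u < y" "y < v" "0 < \<epsilon>"
  obtains \<omega> where "\<omega> \<in> lists I" "0 < \<rho> \<omega>" "\<rho> \<omega> < \<epsilon>"
    "\<And>x. x \<in> {0..1} \<Longrightarrow> u < S \<omega> x \<and> S \<omega> x < v"
proof -
  \<comment> \<open>A piece shorter than \<open>\<delta>\<close> through \<open>y\<close> stays
    between \<open>u\<close> and \<open>v\<close>, and its ratio is below
    \<open>\<epsilon>\<close>.\<close>
  define \<delta> where "\<delta> = min \<epsilon> (min (y - u) (v - y))"
  have "0 < \<delta>" using assms by (simp add: \<delta>_def)
  then obtain n where n: "\<And>\<sigma>. \<sigma> \<in> lists I \<Longrightarrow> n \<le> length \<sigma> \<Longrightarrow> \<bar>\<rho> \<sigma>\<bar> < \<delta>"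
    using long_words_small by blast
  obtain \<sigma> z where \<sigma>: "\<sigma> \<in> lists I" "length \<sigma> = n" "z \<in> K" "S \<sigma> z = y"
    using word_covering[OF assms(1)] by metis
  have small: "\<bar>\<rho> \<sigma>\<bar> < \<delta>" using n \<sigma> by simp
  have inside: "u < S \<sigma> x \<and> S \<sigma> x < v" if "x \<in> {0..1}" for x
  proof -
    have "\<bar>x - z\<bar> \<le> 1" using that \<sigma>(3) K_subset by force
    then have "\<bar>\<rho> \<sigma>\<bar> * \<bar>x - z\<bar> \<le> \<bar>\<rho> \<sigma>\<bar>" by (simp add: mult_left_le)
    then have "\<bar>S \<sigma> x - y\<bar> < \<delta>"
      using small word_map_diff[of r d \<sigma> x z] \<sigma>(4) by (simp add: abs_mult)
    then show ?thesis by (auto simp: \<delta>_def)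
  qed
  show ?thesis
  proof (cases "0 < \<rho> \<sigma>")
    case True
    then show ?thesis using that[of \<sigma>] \<sigma>(1) small inside by (simp add: \<delta>_def)
  next
    case False
    have "\<exists>i\<in>I. r i < 0" if "\<tau> \<in> lists I" "\<rho> \<tau> < 0" for \<tau>
      using that by (induction \<tau>) (auto simp: mult_less_0_iff)
    moreover have neg: "\<rho> \<sigma> < 0" using False ratio_nonzero[OF \<sigma>(1)] by simp
    ultimately obtain i where i: "i \<in> I" "r i < 0" using \<sigma>(1) by blast
    have \<omega>: "\<sigma> @ [i] \<in> lists I" using \<sigma>(1) i by simp
    have "0 < \<rho> (\<sigma> @ [i])" using neg i by (simp add: mult_neg_neg)
    moreover have "\<rho> (\<sigma> @ [i]) < \<epsilon>"
      using ratio_append_le[of "[i]" \<sigma>] i(1) small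
        abs_ge_self[of "\<rho> (\<sigma> @ [i])"] unfolding \<delta>_def by fastforce
    moreover have "u < S (\<sigma> @ [i]) x \<and> S (\<sigma> @ [i]) x < v" if "x \<in> {0..1}" for x
      using inside[OF word_map_unit[of "[i]" x]] i(1) that by (simp add: word_map_append)
    ultimately show ?thesis using that \<omega> by blast
  qed
qed

text \<open>The ends of a small piece of \<open>K\<close> between \<open>u\<close> and
  \<open>v\<close> are endpoints of a fine generation. The piece is infinite while the endpoints are
  finite in number, so some point of it lies strictly between consecutive endpoints.\<close>

lemma net_interval_inside:
  assumes "y \<in> K" "u < y" "y < v" "0 < t"
  obtains s a b where "0 < s" "s \<le> t" "{a..b} \<in> F s" "u < a" "a < b" "b < v"
proof -
  obtain \<eta> where \<eta>: "\<eta> \<in> lists I" "0 < \<rho> \<eta>"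
    "\<And>x. x \<in> {0..1} \<Longrightarrow> u < S \<eta> x \<and> S \<eta> x < v"
    using positive_word_inside[OF assms(1-3) zero_less_one] by metis
  \<comment> \<open>The largest generation up to \<open>t\<close> at which
    \<open>endpoint_refine\<close> applies to \<open>\<eta>\<close>; the empty word imposes no
    bound.\<close>
  define s where "s = (if \<eta> = [] then t else min t \<bar>\<rho> (butlast \<eta>)\<bar>)"
  have s: "0 < s" "s \<le> t" "\<eta> = [] \<or> s \<le> \<bar>\<rho> (butlast \<eta>)\<bar>"
    using assms(4) ratio_nonzero[OF butlast_in_lists[OF \<eta>(1)]] by (auto simp: s_def)
  have ends: "S \<eta> 0 \<in> E s" "S \<eta> 1 \<in> E s"
    using endpoint_refine[OF \<eta>(1) s(3) _ s(1)] by auto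
  have "infinite (S \<eta> ` K)"
    using infinite_K inj_on_subset[OF inj_word_map[OF \<eta>(1)]] by (simp add: finite_image_iff)
  then have "\<not> S \<eta> ` K \<subseteq> E s"
    using finite_endpoints[OF s(1)] finite_subset by blast
  then obtain z where z: "z \<in> K" "S \<eta> z \<notin> E s" by blast
  then have zK: "S \<eta> z \<in> K" using \<eta>(1) word_map_K by blast
  have "S \<eta> 0 \<le> S \<eta> z" "S \<eta> z \<le> S \<eta> 1"
    using z(1) K_subset word_map_less_iff[OF \<eta>(2)] by (force simp: not_less[symmetric])+
  then obtain a b where ab: "a \<in> E s" "b \<in> E s" "S \<eta> 0 \<le> a" "a \<le> S \<eta> z" "S \<eta> z \<le> b"
    "b \<le> S \<eta> 1" "E s \<inter> {a<..<b} = {}"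
    using consecutive_around[OF finite_endpoints[OF s(1)] ends, of "S \<eta> z" "S \<eta> z"] by auto
  have lt: "a < S \<eta> z" "S \<eta> z < b" using ab z(2) by (auto simp: less_le)
  then have "{a<..<b} \<inter> K \<noteq> {}" using zK by auto
  then have "{a..b} \<in> F s" using ab lt by (intro net_intervalI) auto
  moreover have "u < a" "b < v" using \<eta>(3)[of 0] \<eta>(3)[of 1] ab by auto
  ultimately show ?thesis using that s lt by auto
qed

text \<open>Since \<open>s \<le> 1\<close>, \<open>\<sigma>\<close> is not empty, so the predecessor
  of \<open>\<omega> @ \<sigma>\<close> is \<open>\<omega> @ butlast \<sigma>\<close> and both ratio
  bounds scale by the ratio of \<open>\<omega>\<close>.\<close>

lemma words_gen_append:
  assumes "\<omega> \<in> lists I" "\<sigma> \<in> \<Lambda> s" "s \<le> 1"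
  shows "\<omega> @ \<sigma> \<in> \<Lambda> (\<bar>\<rho> \<omega>\<bar> * s)"
proof -
  have "\<sigma> \<noteq> []" using words_genD(2)[OF assms(2)] assms(3) by auto
  then show ?thesis
    using words_genD[OF assms(2)] assms(1) ratio_nonzero[OF assms(1)]
    by (auto simp: words_gen_def butlast_append abs_mult)
qed

text \<open>The ball meets the maximal number of maps of its generation, among generations
  restricted to \<open>t \<le> 1\<close> so that \<open>\<Lambda>\<^sub>t\<close> does not contain the empty word and
  prepending a word rescales the generation.\<close>

lemma saturated_ball:
  assumes "weak_separation I r d K"
  obtains x t where "0 < t" "t \<le> 1" "ball x t \<inter> K \<noteq> {}"
    "\<And>\<omega>. \<omega> \<in> lists I \<Longrightarrow>
      maps_meeting I r d K (\<bar>\<rho> \<omega>\<bar> * t) (ball (S \<omega> x) (\<bar>\<rho> \<omega>\<bar> * t))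
      \<subseteq> (\<lambda>f. S \<omega> \<circ> f) ` maps_meeting I r d K t (ball x t)"
proof -
  define M where "M x t = maps_meeting I r d K t (ball x t)" for x t
  obtain N where N: "\<And>x t. 0 < t \<Longrightarrow> finite (M x t)" "\<And>x t. 0 < t \<Longrightarrow> card (M x t) \<le> N"
    using assms unfolding weak_separation_def M_def by blast
  \<comment> \<open>Weak separation bounds the cardinalities by \<open>N\<close>, so a maximum is
    attained; \<open>(0, 1)\<close> is an admissible pair.\<close>
  have "\<exists>p. (0 < snd p \<and> snd p \<le> 1) \<and> (\<forall>q. 0 < snd q \<and> snd q \<le> 1
      \<longrightarrow> card (M (fst q) (snd q)) \<le> card (M (fst p) (snd p)))"
    by (rule ex_has_greatest_nat[of _ "(0, 1)" _ "Suc N"]) (use N(2) in \<open>auto simp: less_Suc_eq_le\<close>)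
  then obtain x t where t: "0 < t" "t \<le> 1"
    and max: "\<And>y u. 0 < u \<Longrightarrow> u \<le> 1 \<Longrightarrow> card (M y u) \<le> card (M x t)"
    by auto
  \<comment> \<open>The unit ball at 0 meets at least one map, so the maximum is positive and the
    maximal ball meets \<open>K\<close>.\<close>
  obtain \<sigma> where \<sigma>: "\<sigma> \<in> \<Lambda> 1" "0 \<in> S \<sigma> ` K"
    using words_gen_covering[OF zero_in_K zero_less_one] by blast
  have "0 \<in> ball (0::real) 1" by simp
  with \<sigma> have "S \<sigma> \<in> M 0 1" unfolding M_def maps_meeting_def by blast
  then have "0 < card (M 0 1)" using N(1)[of 1 0] card_gt_0_iff by auto
  also have "\<dots> \<le> card (M x t)" using max by simp
  finally have "M x t \<noteq> {}" by auto
  then obtain \<tau> where "\<tau> \<in> \<Lambda> t" "S \<tau> ` K \<inter> ball x t \<noteq> {}"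
    by (auto simp: M_def maps_meeting_def)
  then have meets: "ball x t \<inter> K \<noteq> {}" using words_genD(1) word_map_K by blast
  have sat: "M (S \<omega> x) (\<bar>\<rho> \<omega>\<bar> * t) \<subseteq> (\<lambda>f. S \<omega> \<circ> f) ` M x t" if \<omega>: "\<omega> \<in> lists I" for \<omega>
  proof -
    have pos: "0 < \<bar>\<rho> \<omega>\<bar>" using ratio_nonzero[OF \<omega>] by simp
    then have gen: "0 < \<bar>\<rho> \<omega>\<bar> * t" "\<bar>\<rho> \<omega>\<bar> * t \<le> 1"
      using t ratio_le_1[OF \<omega>] by (simp_all add: mult_le_one)
    have sub: "(\<lambda>f. S \<omega> \<circ> f) ` M x t \<subseteq> M (S \<omega> x) (\<bar>\<rho> \<omega>\<bar> * t)"
    proof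
      fix g assume "g \<in> (\<lambda>f. S \<omega> \<circ> f) ` M x t"
      then obtain \<sigma> z where \<sigma>: "g = S \<omega> \<circ> S \<sigma>" "\<sigma> \<in> \<Lambda> t" "z \<in> K" "S \<sigma> z \<in> ball x t"
        unfolding M_def maps_meeting_def by blast
      have "S (\<omega> @ \<sigma>) z \<in> ball (S \<omega> x) (\<bar>\<rho> \<omega>\<bar> * t)"
        using \<sigma>(4) pos word_map_diff[of r d \<omega> x "S \<sigma> z"]
        by (simp add: dist_real_def abs_mult word_map_append)
      then have "S (\<omega> @ \<sigma>) ` K \<inter> ball (S \<omega> x) (\<bar>\<rho> \<omega>\<bar> * t) \<noteq> {}" using \<sigma>(3) by blast
      then have "S (\<omega> @ \<sigma>) \<in> M (S \<omega> x) (\<bar>\<rho> \<omega>\<bar> * t)"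
        unfolding M_def maps_meeting_def using words_gen_append[OF \<omega> \<sigma>(2) t(2)] by blast
      then show "g \<in> M (S \<omega> x) (\<bar>\<rho> \<omega>\<bar> * t)" using \<sigma>(1) by (simp add: word_map_append)
    qed
    \<comment> \<open>The copied maps are as many as the originals, so maximality leaves no room for
      further ones.\<close>
    have "inj (\<lambda>f::real \<Rightarrow> real. S \<omega> \<circ> f)"
      using inj_word_map[OF \<omega>] by (rule fun.inj_map)
    then have "card ((\<lambda>f. S \<omega> \<circ> f) ` M x t) = card (M x t)"
      by (meson card_image inj_on_subset subset_UNIV)
    then have "card (M (S \<omega> x) (\<bar>\<rho> \<omega>\<bar> * t)) \<le> card ((\<lambda>f. S \<omega> \<circ> f) ` M x t)"
      using max[OF gen] by simp
    then show ?thesis using card_seteq[OF N(1)[OF gen(1)] sub] by blast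
  qed
  show ?thesis using that[OF t meets] sat unfolding M_def by blast
qed

text \<open>Saturation says that near the copy every map of generation
  \<open>\<rho> \<omega> * t\<close> factors through \<open>S \<omega>\<close>. This passes down to
  generation \<open>\<rho> \<omega> * s\<close>, so neither endpoints nor neighbours inside the copy
  are new.\<close>

lemma scaled_net_interval:
  assumes \<omega>: "\<omega> \<in> lists I" "0 < \<rho> \<omega>"
    and t: "0 < s" "s \<le> t" "t \<le> 1"
    and sat: "maps_meeting I r d K (\<rho> \<omega> * t) (ball (S \<omega> x) (\<rho> \<omega> * t))
      \<subseteq> (\<lambda>f. S \<omega> \<circ> f) ` maps_meeting I r d K t (ball x t)"
    and \<Delta>: "{a..b} \<in> F s" "a < b" "a \<in> ball x t" "b \<in> ball x t"
  shows "{S \<omega> a..S \<omega> b} \<in> F (\<rho> \<omega> * s)"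
    and "V (\<rho> \<omega> * s) {S \<omega> a..S \<omega> b} = V s {a..b}"
proof -
  have ab: "a \<in> E s" "b \<in> E s" "E s \<inter> {a<..<b} = {}" "{a<..<b} \<inter> K \<noteq> {}"
    using \<Delta>(1,2) by (auto elim!: net_intervalE simp: Icc_eq_Icc)
  have less: "S \<omega> p < S \<omega> q \<longleftrightarrow> p < q" for p q using word_map_less_iff[OF \<omega>(2)] .
  have fwd: "\<omega> @ \<sigma> \<in> \<Lambda> (\<rho> \<omega> * s)" if "\<sigma> \<in> \<Lambda> s" for \<sigma>
    using words_gen_append[OF \<omega>(1) that] t \<omega>(2) by simp
  have ends: "S \<omega> p \<in> E (\<rho> \<omega> * s)" if p: "p \<in> E s" for p
  proof -
    obtain \<sigma> e where \<sigma>: "\<sigma> \<in> \<Lambda> s" "e \<in> {0, 1}" "p = S \<sigma> e"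
      using endpointE[OF p] by metis
    then have "S \<omega> p = S (\<omega> @ \<sigma>) e" by (simp add: word_map_append)
    then show ?thesis using fwd[OF \<sigma>(1)] \<sigma>(2) unfolding endpoints_gen_def by auto
  qed
  \<comment> \<open>Saturation is known at generation \<open>t\<close> only: cut
    \<open>\<tau>\<close> there into \<open>u @ v\<close>, replace \<open>u\<close> by
    \<open>\<omega> @ \<sigma>\<close> with the same map, and keep the tail
    \<open>v\<close>.\<close>
  have pull: "\<exists>\<sigma>\<in>\<Lambda> s. S \<tau> = S \<omega> \<circ> S \<sigma>"
    if \<tau>: "\<tau> \<in> \<Lambda> (\<rho> \<omega> * s)" and z: "z \<in> K" "S \<omega> a < S \<tau> z" "S \<tau> z < S \<omega> b" for \<tau> z
  proof -
    have "\<rho> \<omega> * s \<le> \<rho> \<omega> * t" using \<omega>(2) t by simp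
    then have "\<bar>\<rho> \<tau>\<bar> < \<rho> \<omega> * t" using words_genD(2)[OF \<tau>] by linarith
    then obtain u v where uv: "\<tau> = u @ v" "u \<in> \<Lambda> (\<rho> \<omega> * t)" "v \<in> lists I"
      using prefix_in_words_gen[OF words_genD(1)[OF \<tau>]] by blast
    have "S \<omega> x - S \<omega> a < \<rho> \<omega> * t" "S \<omega> b - S \<omega> x < \<rho> \<omega> * t"
      using \<Delta>(3,4) \<omega>(2) by (auto simp: word_map_diff dist_real_def)
    then have "S u (S v z) \<in> ball (S \<omega> x) (\<rho> \<omega> * t)"
      using z(2,3) uv(1) by (auto simp: dist_real_def word_map_append)
    then have "S u ` K \<inter> ball (S \<omega> x) (\<rho> \<omega> * t) \<noteq> {}" using word_map_K[OF uv(3) z(1)] by blast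
    then have "S u \<in> maps_meeting I r d K (\<rho> \<omega> * t) (ball (S \<omega> x) (\<rho> \<omega> * t))"
      using uv(2) unfolding maps_meeting_def by blast
    then obtain \<sigma> where \<sigma>: "\<sigma> \<in> \<Lambda> t" and u: "S u = S \<omega> \<circ> S \<sigma>"
      using sat unfolding maps_meeting_def by blast
    have "\<rho> u = S \<omega> (S \<sigma> 1) - S \<omega> (S \<sigma> 0)"
      unfolding word_ratio_eq_diff[of r u d] u by simp
    also have "\<dots> = \<rho> \<omega> * \<rho> \<sigma>"
      by (simp add: word_map_diff)
    finally have "\<rho> u = \<rho> \<omega> * \<rho> \<sigma>" .
    then have "\<bar>\<rho> \<tau>\<bar> = \<rho> \<omega> * \<bar>\<rho> (\<sigma> @ v)\<bar>"
      and bl: "v \<noteq> [] \<Longrightarrow> \<bar>\<rho> (butlast \<tau>)\<bar> = \<rho> \<omega> * \<bar>\<rho> (butlast (\<sigma> @ v))\<bar>"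
      using uv(1) \<omega>(2) by (simp_all add: abs_mult butlast_append)
    then have lt: "\<bar>\<rho> (\<sigma> @ v)\<bar> < s"
      using words_genD(2)[OF \<tau>] \<omega>(2) by simp
    \<comment> \<open>For empty \<open>v\<close> the bound comes from
      \<open>\<sigma> \<in> \<Lambda> t\<close> and \<open>s \<le> t\<close>. Otherwise the deleted
      letter belongs to \<open>v\<close>, and the bound for \<open>\<tau>\<close> is divided by
      \<open>\<rho> \<omega>\<close>.\<close>
    have "s \<le> \<bar>\<rho> (butlast (\<sigma> @ v))\<bar>"
    proof (cases "v = []")
      case True
      have "\<sigma> \<noteq> []" using words_genD(2)[OF \<sigma>] t(3) by auto
      then show ?thesis using words_genD(3)[OF \<sigma>] t(2) True by simp
    next
      case False
      then have "\<rho> \<omega> * s \<le> \<rho> \<omega> * \<bar>\<rho> (butlast (\<sigma> @ v))\<bar>"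
        using words_genD(3)[OF \<tau>] uv(1) bl by simp
      then show ?thesis using \<omega>(2) by simp
    qed
    then have "\<sigma> @ v \<in> \<Lambda> s"
      using lt words_genD(1)[OF \<sigma>] uv(3) by (simp add: words_gen_def)
    moreover have "S \<tau> = S \<omega> \<circ> S (\<sigma> @ v)"
      using uv(1) u by (simp add: word_map_append comp_assoc)
    ultimately show ?thesis by blast
  qed
  have "E (\<rho> \<omega> * s) \<inter> {S \<omega> a<..<S \<omega> b} = {}"
  proof (rule ccontr)
    assume "E (\<rho> \<omega> * s) \<inter> {S \<omega> a<..<S \<omega> b} \<noteq> {}"
    then obtain \<tau> e where \<tau>: "\<tau> \<in> \<Lambda> (\<rho> \<omega> * s)" "e \<in> {0, 1}" "S \<omega> a < S \<tau> e" "S \<tau> e < S \<omega> b"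
      using endpointE by (metis IntE ex_in_conv greaterThanLessThan_iff)
    then have "e \<in> K" using zero_in_K one_in_K by auto
    then obtain \<sigma> where "\<sigma> \<in> \<Lambda> s" "S \<tau> = S \<omega> \<circ> S \<sigma>" using pull \<tau> by blast
    then have "S \<sigma> e \<in> E s" "S \<sigma> e \<in> {a<..<b}"
      using \<tau> by (auto simp: endpoints_gen_def less)
    then show False using ab(3) by blast
  qed
  moreover have "{S \<omega> a<..<S \<omega> b} \<inter> K \<noteq> {}"
  proof -
    obtain k where "k \<in> K" "a < k" "k < b" using ab(4) by auto
    then have "S \<omega> k \<in> {S \<omega> a<..<S \<omega> b} \<inter> K" using word_map_K[OF \<omega>(1)] by (simp add: less)
    then show ?thesis by blast
  qed
  ultimately show "{S \<omega> a..S \<omega> b} \<in> F (\<rho> \<omega> * s)"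
    using ends[OF ab(1)] ends[OF ab(2)] \<Delta>(2) by (intro net_intervalI) (simp_all add: less)
  \<comment> \<open>As \<open>S \<omega>\<close> is increasing, the normalizing map of the copy is
    \<open>S \<omega>\<close> after that of the original, and \<open>S \<omega>\<close>
    cancels.\<close>
  have rescale: "inv (interval_map {S \<omega> a..S \<omega> b}) \<circ> (S \<omega> \<circ> f) = inv (interval_map {a..b}) \<circ> f"
    for f :: "real \<Rightarrow> real"
    using interval_map_Icc(2)[of "S \<omega> a" "S \<omega> b"] interval_map_Icc(2)[OF \<Delta>(2)] \<Delta>(2) \<omega>(2)
    by (simp add: less word_map_diff fun_eq_iff)
  show "V (\<rho> \<omega> * s) {S \<omega> a..S \<omega> b} = V s {a..b}"
  proof (intro equalityI subsetI)
    fix g assume "g \<in> V (\<rho> \<omega> * s) {S \<omega> a..S \<omega> b}"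
    then obtain \<tau> z where \<tau>: "\<tau> \<in> \<Lambda> (\<rho> \<omega> * s)" "z \<in> K" "S \<omega> a < S \<tau> z" "S \<tau> z < S \<omega> b"
      and g: "g = inv (interval_map {S \<omega> a..S \<omega> b}) \<circ> S \<tau>"
      by (rule neighbour_setE)
    then obtain \<sigma> where \<sigma>: "\<sigma> \<in> \<Lambda> s" "S \<tau> = S \<omega> \<circ> S \<sigma>" using pull by blast
    then have "\<sigma> \<in> neighbour_words s {a..b}"
      using \<tau> by (auto simp: neighbour_words_def less)
    then show "g \<in> V s {a..b}"
      unfolding neighbour_set_eq g \<sigma>(2) rescale by blast
  next
    fix g assume "g \<in> V s {a..b}"
    then obtain \<sigma> z where \<sigma>: "\<sigma> \<in> \<Lambda> s" "z \<in> K" "a < S \<sigma> z" "S \<sigma> z < b"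
      and g: "g = inv (interval_map {a..b}) \<circ> S \<sigma>"
      by (rule neighbour_setE)
    have "S (\<omega> @ \<sigma>) z \<in> S (\<omega> @ \<sigma>) ` K \<inter> interior {S \<omega> a..S \<omega> b}"
      using \<sigma> by (simp add: word_map_append less)
    then have "\<omega> @ \<sigma> \<in> neighbour_words (\<rho> \<omega> * s) {S \<omega> a..S \<omega> b}"
      using fwd[OF \<sigma>(1)] unfolding neighbour_words_def by blast
    moreover have "g = inv (interval_map {S \<omega> a..S \<omega> b}) \<circ> S (\<omega> @ \<sigma>)"
      unfolding g word_map_append rescale ..
    ultimately show "g \<in> V (\<rho> \<omega> * s) {S \<omega> a..S \<omega> b}"
      unfolding neighbour_set_eq by blast
  qed
qed

section \<open>A vertex reachable from every vertex\<close>

lemma globally_reachable_vertex: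
  assumes "weak_separation I r d K"
  obtains v0 where "v0 \<in> verts G" "\<And>v. v \<in> verts G \<Longrightarrow> path_from_to G v v0"
proof -
  obtain x t where t: "0 < t" "t \<le> 1" and meets: "ball x t \<inter> K \<noteq> {}"
    and sat: "\<And>\<omega>. \<omega> \<in> lists I \<Longrightarrow>
      maps_meeting I r d K (\<bar>\<rho> \<omega>\<bar> * t) (ball (S \<omega> x) (\<bar>\<rho> \<omega>\<bar> * t))
      \<subseteq> (\<lambda>f. S \<omega> \<circ> f) ` maps_meeting I r d K t (ball x t)"
    using saturated_ball[OF assms] by metis
  obtain y where y: "y \<in> K" "x - t < y" "y < x + t"
    using meets by (auto simp: ball_eq_greaterThanLessThan)
  \<comment> \<open>The neighbour set of this net interval inside the saturated ball is the vertex
    sought.\<close>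
  obtain s a b where s: "0 < s" "s \<le> t" and ab: "{a..b} \<in> F s" "x - t < a" "a < b" "b < x + t"
    using net_interval_inside[OF y t(1)] by metis
  have ball: "a \<in> ball x t" "b \<in> ball x t"
    using ab by (auto simp: ball_eq_greaterThanLessThan)
  have "a \<in> E s" "b \<in> E s"
    using ab by (auto elim!: net_intervalE simp: Icc_eq_Icc)
  then have unit: "a \<in> {0..1}" "b \<in> {0..1}"
    using endpoints_subset_K K_subset by blast+
  have "V s {a..b} \<in> verts G"
    using s ab by (auto simp: transition_graph_def)
  moreover have "path_from_to G v (V s {a..b})" if v: "v \<in> verts G" for v
  proof -
    obtain u \<Delta> where \<Delta>: "0 < u" "\<Delta> \<in> F u" "v = V u \<Delta>"
      using v by (auto simp: transition_graph_def)
    obtain a' b' where ab': "\<Delta> = {a'..b'}" "{a'<..<b'} \<inter> K \<noteq> {}"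
      using net_intervalE[OF \<Delta>(2)] by metis
    then obtain k where k: "k \<in> K" "a' < k" "k < b'" by auto
    \<comment> \<open>A ratio below \<open>tg u \<Delta>\<close>, together with
      \<open>s \<le> 1\<close>, puts the copy at a generation that \<open>path_to_descendant\<close>
      accepts.\<close>
    obtain \<omega> where \<omega>: "\<omega> \<in> lists I" "0 < \<rho> \<omega>" "\<rho> \<omega> < tg u \<Delta>"
      "\<And>x. x \<in> {0..1} \<Longrightarrow> a' < S \<omega> x \<and> S \<omega> x < b'"
      using positive_word_inside[OF k transition_gen_bounds(1)[OF \<Delta>(1,2)]] by metis
    note scaled = scaled_net_interval[OF \<omega>(1,2) s t(2) _ ab(1,3) ball]
    have sat': "maps_meeting I r d K (\<rho> \<omega> * t) (ball (S \<omega> x) (\<rho> \<omega> * t))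
        \<subseteq> (\<lambda>f. S \<omega> \<circ> f) ` maps_meeting I r d K t (ball x t)"
      using sat[OF \<omega>(1)] \<omega>(2) by simp
    have "{S \<omega> a..S \<omega> b} \<subseteq> \<Delta>"
      using \<omega>(4)[OF unit(1)] \<omega>(4)[OF unit(2)] ab'(1) by auto
    moreover have "\<rho> \<omega> * s \<le> tg u \<Delta>"
      using mult_left_le[of s "\<rho> \<omega>"] \<omega>(2,3) s t by linarith
    moreover have "0 < \<rho> \<omega> * s" using \<omega>(2) s(1) by simp
    ultimately have "path_from_to G (V u \<Delta>) (V (\<rho> \<omega> * s) {S \<omega> a..S \<omega> b})"
      using path_to_descendant[OF _ scaled(1)[OF sat'] \<Delta>(1,2)] by blast
    then show ?thesis using scaled(2)[OF sat'] \<Delta>(3) by simp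
  qed
  ultimately show ?thesis using that by blast
qed

end

theorem proposition3p5:
  fixes I :: "'i set" and r d :: "'i \<Rightarrow> real" and K :: "real set"
  assumes "similarity_ifs I r"
    and "is_attractor I r d K"
    and "\<nexists>x. K = {x}"
    and "convex hull K = {0..1}"
    and "weak_separation I r d K"
  shows "\<exists>!H. essential_class H (transition_graph I r d K)"
proof -
  interpret normalized_ifs I r d K
    using assms(1,2,4) by unfold_locales
  show ?thesis
    using globally_reachable_vertex[OF assms(5)] graph.ex1_essential_class by metis
qed

end
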